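(* Let $n\geq 1$ and let $\mathcal{F}$ be a family of subsets of $\{1,2,\ldots,n\}$. For $F,F'\in\mathcal{F}$ let $d(F,F')$ denote the cardinality of the symmetric difference $F\oplus F'=(F\setminus F')\cup(F'\setminus F)$. If for every two distinct $F,F'\in\mathcal{F}$ the number $d(F,F')$ is not a multiple of $4$, then $$|\mathcal{F}|\leq\begin{cases}2n, & n\equiv 0,1,2 \pmod 4,\\ 2n+2, & n\equiv 3\pmod 4.\end{cases}$$ Moreover, this bound is sharp: for every $n$ there exists such a family $\mathcal{F}$ attaining it. *)

theory Defs
  imports Main
begin

definition set_dist :: "nat set \<Rightarrow> nat set \<Rightarrow> nat" where
  "set_dist F F' = card (sym_diff F F')"

definition dist_avoids_multiples_of_4 :: "nat set set \<Rightarrow> bool" where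
  "dist_avoids_multiples_of_4 \<F> \<longleftrightarrow> (\<forall>F\<in>\<F>. \<forall>F'\<in>\<F>. F \<noteq> F' \<longrightarrow> \<not> 4 dvd set_dist F F')"

definition size_bound :: "nat \<Rightarrow> nat" where
  "size_bound n = (if n mod 4 = 3 then 2 * n + 2 else 2 * n)"

end

(*
  Distances within the even members of the family, and within the odd members, are all congruent
  to 2 modulo 4. Translating such a subfamily so that it contains the empty set, its remaining m
  members have size 2 modulo 4 and pairwise odd intersections. If m is at least n, pigeonhole
  (linear dependence over GF(2), inside the even-size subsets of an n-set) gives a nonempty
  subfamily D with symmetric difference empty. Intersecting with each member shows that D is the
  whole subfamily and that m is odd; counting the size of the symmetric difference modulo 4
  then forces 4 | m(m+1), hence m = 3 mod 4. The same holds for every subfamily with at least n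
  members, so m < n, unless m = n = 3 mod 4.
  For sharpness take the singletons, together with the whole set if n = 3 mod 4, and the
  translates of all these by {1}.
*)
theory Submission
  imports Defs
begin

section \<open>Parity and translation for symmetric differences\<close>

lemma card_sym_diff_add_Int:
  assumes "finite A" "finite B"
  shows "card (sym_diff A B) + 2 * card (A \<inter> B) = card A + card B"
proof -
  have "card (sym_diff A B) = card (A - B) + card (B - A)"
    using assms by (intro card_Un_disjoint) auto
  moreover have "card A = card (A - B) + card (A \<inter> B)"
    using assms card_Diff_subset_Int[of A B] card_mono[of A "A \<inter> B"] by auto
  moreover have "card B = card (B - A) + card (A \<inter> B)"
    using assms card_Diff_subset_Int[of B A] card_mono[of B "A \<inter> B"] by (auto simp: Int_commute)
  ultimately show ?thesis by simp
qed

lemma even_card_sym_diff: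
  assumes "finite A" "finite B"
  shows "even (card (sym_diff A B)) \<longleftrightarrow> (even (card A) \<longleftrightarrow> even (card B))"
  using card_sym_diff_add_Int[OF assms] by presburger

lemma sym_diff_cancel: "sym_diff (sym_diff C A) (sym_diff C B) = sym_diff A B"
  by blast

lemma inj_sym_diff: "inj_on (sym_diff C) U"
  by (rule inj_onI) blast

text \<open>For finite \<open>S\<close> this is the sum of the members of \<open>S\<close> as
  vectors over GF(2), that is, their iterated symmetric difference. A nonempty \<open>S\<close> with
  \<open>odd_cover S = {}\<close> is therefore a linear dependence.\<close>

definition odd_cover :: "'a set set \<Rightarrow> 'a set" where
  "odd_cover S = {x. odd (card {A\<in>S. x \<in> A})}"

lemma odd_cover_empty [simp]: "odd_cover {} = {}"
  by (simp add: odd_cover_def)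

lemma odd_cover_subset: "odd_cover S \<subseteq> \<Union>S"
proof
  fix x assume "x \<in> odd_cover S"
  then have "{A\<in>S. x \<in> A} \<noteq> {}"
    unfolding odd_cover_def by (metis (lifting) card.empty even_zero mem_Collect_eq)
  then show "x \<in> \<Union>S" by blast
qed

lemma odd_cover_sym_diff:
  assumes "finite S" "finite T"
  shows "odd_cover (sym_diff S T) = sym_diff (odd_cover S) (odd_cover T)"
proof -
  have *: "{A \<in> sym_diff S T. x \<in> A} = sym_diff {A\<in>S. x \<in> A} {A\<in>T. x \<in> A}" for x
    by blast
  have "even (card {A \<in> sym_diff S T. x \<in> A})
      \<longleftrightarrow> (even (card {A\<in>S. x \<in> A}) \<longleftrightarrow> even (card {A\<in>T. x \<in> A}))" for x
    unfolding * by (rule even_card_sym_diff) (use assms in auto)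
  then show ?thesis
    unfolding odd_cover_def by blast
qed

lemma odd_cover_insert:
  assumes "finite S" "A \<notin> S"
  shows "odd_cover (insert A S) = sym_diff (odd_cover S) A"
proof -
  have "odd_cover {A} = A"
  proof -
    have "{B \<in> {A}. x \<in> B} = (if x \<in> A then {A} else {})" for x by auto
    then show ?thesis by (auto simp: odd_cover_def)
  qed
  moreover have "insert A S = sym_diff S {A}" using assms by blast
  ultimately show ?thesis using assms odd_cover_sym_diff[of S "{A}"] by simp
qed

text \<open>Bilinearity of the GF(2) inner product: the pairs (x, A) with x in A \<inter> W are
  counted by x and by A, and both counts are read modulo 2.\<close>

lemma even_card_odd_cover_Int:
  assumes "finite S" "finite W"
  shows "even (card (odd_cover S \<inter> W)) \<longleftrightarrow> even (card {A\<in>S. odd (card (A \<inter> W))})"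
proof -
  have "(\<Sum>x\<in>W. card {A\<in>S. x \<in> A}) = (\<Sum>A\<in>S. card {x\<in>W. x \<in> A})"
    using assms by (intro sum_multicount_gen) auto
  moreover have "{x\<in>W. x \<in> A} = A \<inter> W" for A by blast
  moreover have "{x\<in>W. odd (card {A\<in>S. x \<in> A})} = odd_cover S \<inter> W"
    by (auto simp: odd_cover_def)
  ultimately show ?thesis
    using even_sum_iff[OF assms(2), of "\<lambda>x. card {A\<in>S. x \<in> A}"]
      even_sum_iff[OF assms(1), of "\<lambda>A. card (A \<inter> W)"] by simp
qed

section \<open>Sets of size 2 modulo 4 with pairwise odd intersections\<close>

definition oddtown_mod4 :: "'a set set \<Rightarrow> bool" where
  "oddtown_mod4 S \<longleftrightarrow> (\<forall>A\<in>S. card A mod 4 = 2) \<and> (\<forall>A\<in>S. \<forall>B\<in>S. A \<noteq> B \<longrightarrow> odd (card (A \<inter> B)))"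

lemma oddtown_mod4_subset: "oddtown_mod4 S \<Longrightarrow> T \<subseteq> S \<Longrightarrow> oddtown_mod4 T"
  unfolding oddtown_mod4_def by blast

text \<open>Infinite sets have \<open>card\<close> 0, which is not 2 modulo 4.\<close>

lemma oddtown_mod4_finite: "oddtown_mod4 S \<Longrightarrow> A \<in> S \<Longrightarrow> finite A"
  unfolding oddtown_mod4_def by (metis card.infinite mod_0 zero_neq_numeral)

text \<open>Let m = |S|. Adding A changes the size of the sum by |A| - 2t, where t, the size of its
  overlap with A, has the parity of m because every earlier member meets A oddly. Modulo 4 the
  change is 2 - 2m, while m(m+1) grows by 2m + 2, so the total gains 4.\<close>

lemma card_odd_cover_oddtown:
  assumes "finite S" "oddtown_mod4 S"
  shows "4 dvd card (odd_cover S) + card S * (card S + 1)"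
  using assms
proof (induction S)
  case empty
  then show ?case by simp
next
  case (insert A S)
  have S: "oddtown_mod4 S" using insert.prems by (rule oddtown_mod4_subset) auto
  have fin: "finite A" "finite (odd_cover S)"
    using insert.prems insert.hyps(1) oddtown_mod4_finite odd_cover_subset[of S]
    by (auto intro!: finite_subset[OF odd_cover_subset])
  have "odd (card (B \<inter> A))" if "B \<in> S" for B
    using insert.prems insert.hyps(2) that unfolding oddtown_mod4_def by (metis insert_iff)
  then have "{B\<in>S. odd (card (B \<inter> A))} = S" by blast
  then have "even (card (odd_cover S \<inter> A)) \<longleftrightarrow> even (card S)"
    using even_card_odd_cover_Int[OF insert.hyps(1) fin(1)] by simp
  moreover have "card (odd_cover (insert A S)) + 2 * card (odd_cover S \<inter> A) = card (odd_cover S) + card A"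
    using odd_cover_insert[OF insert.hyps] card_sym_diff_add_Int[OF fin(2,1)] by simp
  moreover have "card A mod 4 = 2"
    using insert.prems unfolding oddtown_mod4_def by blast
  moreover have "4 dvd card (odd_cover S) + card S * (card S + 1)"
    by (rule insert.IH[OF S])
  moreover have "card (insert A S) * (card (insert A S) + 1) = card S * (card S + 1) + 2 * card S + 2"
    using insert.hyps by simp
  \<comment> \<open>The products are abstracted to \<open>q\<close> and \<open>q'\<close>, which
    leaves linear arithmetic.\<close>
  moreover have "4 dvd p' + q'"
    if "even t \<longleftrightarrow> even m" "p' + 2 * t = p + a" "a mod 4 = 2" "4 dvd p + q" "q' = q + 2 * m + 2"
    for p p' q q' a t m :: nat
    using that by presburger
  ultimately show ?case by blast
qed

text \<open>The even-size subsets of X form a space of dimension |X| - 1 over GF(2), so |X| of them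
  are dependent.\<close>

lemma exists_odd_cover_empty:
  assumes X: "finite X" "X \<noteq> {}" and S: "S \<subseteq> Pow X" "card X \<le> card S"
    and even: "\<And>A. A \<in> S \<Longrightarrow> even (card A)"
  obtains D where "D \<subseteq> S" "D \<noteq> {}" "odd_cover D = {}"
proof -
  obtain z where z: "z \<in> X" using X by blast
  have finS: "finite S" using S X finite_subset by blast
  \<comment> \<open>Sums of even sets are even, so whether z belongs to one is determined by the
    rest. Removing z halves the range, to fewer than the 2^|S| subfamilies.\<close>
  let ?f = "\<lambda>T. odd_cover T - {z}"
  have "?f ` Pow S \<subseteq> Pow (X - {z})"
  proof (intro image_subsetI PowI)
    fix T assume "T \<in> Pow S"
    then show "?f T \<subseteq> X - {z}" using S(1) odd_cover_subset[of T] by blast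
  qed
  then have "card (?f ` Pow S) \<le> 2 ^ (card X - 1)"
    using card_mono[of "Pow (X - {z})" "?f ` Pow S"] X z by (simp add: card_Pow)
  also have "\<dots> < 2 ^ card S"
  proof (rule power_strict_increasing)
    show "card X - 1 < card S" using S X card_gt_0_iff[of X] by linarith
  qed simp
  finally have "\<not> inj_on ?f (Pow S)"
    using finS by (intro pigeonhole) (simp add: card_Pow)
  then obtain T U where TU: "T \<subseteq> S" "U \<subseteq> S" "T \<noteq> U" "?f T = ?f U"
    unfolding inj_on_def by blast
  let ?D = "sym_diff T U"
  have fin: "finite T" "finite U" using TU finS finite_subset by blast+
  have sub: "?D \<subseteq> S" using TU by blast
  have finD: "finite ?D" using fin by simp
  \<comment> \<open>The collision leaves at most z in the sum; even size, obtained from the double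
    count with W = X, then excludes \<open>{z}\<close>.\<close>
  have "odd_cover ?D \<subseteq> {z}"
    unfolding odd_cover_sym_diff[OF fin] using TU(4) by blast
  moreover have "even (card (odd_cover ?D))"
  proof -
    have "odd_cover ?D \<subseteq> X" using odd_cover_subset[of ?D] sub S(1) by blast
    then have "odd_cover ?D \<inter> X = odd_cover ?D" by blast
    moreover have "{A\<in>?D. odd (card (A \<inter> X))} = {}"
    proof -
      have "even (card (A \<inter> X))" if "A \<in> ?D" for A
      proof -
        have "A \<in> S" using that sub by blast
        moreover from this have "A \<inter> X = A" using S(1) by blast
        ultimately show ?thesis using even by simp
      qed
      then show ?thesis by blast
    qed
    ultimately show ?thesis
      using even_card_odd_cover_Int[OF finD X(1)] by (metis card.empty even_zero)
  qed
  ultimately have "odd_cover ?D = {}"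
    by (cases "odd_cover ?D = {z}") auto
  moreover have "?D \<noteq> {}" using TU(3) by blast
  ultimately show ?thesis using that sub by blast
qed

lemma oddtown_card_mod4:
  assumes X: "finite X" "X \<noteq> {}" and S: "S \<subseteq> Pow X" "card X \<le> card S" "oddtown_mod4 S"
  shows "card S mod 4 = 3"
proof -
  have finS: "finite S" using S X finite_subset by blast
  have evenS: "even (card A)" if "A \<in> S" for A
  proof -
    have "card A mod 4 = 2" using S(3) that unfolding oddtown_mod4_def by blast
    then show ?thesis by presburger
  qed
  obtain D where D: "D \<subseteq> S" "D \<noteq> {}" "odd_cover D = {}"
    using exists_odd_cover_empty[OF X S(1,2)] evenS by blast
  have finD: "finite D" using D finS finite_subset by blast
  \<comment> \<open>The sum of \<open>D\<close> is empty, so an even number of members of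
    \<open>D\<close> meet W oddly. These are all members except W itself, whose size is
    even.\<close>
  have *: "even (card (D - {W}))" if "W \<in> S" for W
  proof -
    have "odd (card (A \<inter> W)) \<longleftrightarrow> A \<noteq> W" if "A \<in> D" for A
      using S(3) D(1) that \<open>W \<in> S\<close> evenS[of W] unfolding oddtown_mod4_def
      by (metis Int_absorb subsetD)
    then have "{A\<in>D. odd (card (A \<inter> W))} = D - {W}" by blast
    then show ?thesis
      using even_card_odd_cover_Int[OF finD oddtown_mod4_finite[OF S(3) that]] D(3) by simp
  qed
  obtain W where W: "W \<in> D" using D by blast
  have "card D = Suc (card (D - {W}))"
    using card_Suc_Diff1[OF finD W] by simp
  moreover have "even (card (D - {W}))" using * W D(1) by blast
  ultimately have oddD: "odd (card D)" by presburger
  \<comment> \<open>For V outside \<open>D\<close>, \<open>D - {V}\<close> is \<open>D\<close>,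
    whose size is odd, against \<open>*\<close>.\<close>
  have "D = S"
  proof (rule ccontr)
    assume "D \<noteq> S"
    then obtain V where "V \<in> S" "V \<notin> D" using D(1) by blast
    then show False using *[of V] oddD by simp
  qed
  then have "4 dvd card S * (card S + 1)" "odd (card S)"
    using card_odd_cover_oddtown[OF finS S(3)] D(3) oddD by simp_all
  moreover have "4 dvd k + 1" if "4 dvd k * (k + 1)" "odd k" for k :: nat
  proof -
    have "coprime 4 k" using that(2)
      by (metis coprime_left_2_iff_odd coprime_power_left_iff mult_2 numeral_Bit0 power2_eq_square)
    then show ?thesis using that(1) coprime_dvd_mult_right_iff by blast
  qed
  ultimately have "4 dvd card S + 1" by blast
  then show ?thesis by presburger
qed

text \<open>\<open>oddtown_card_mod4\<close> applies to subfamilies of every size k from |X| to |S|,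
  so each such k is 3 modulo 4. Two consecutive values cannot both be, and k = |X| is possible only
  if |X| is 3 modulo 4.\<close>

lemma oddtown_card_bound:
  assumes X: "finite X" "X \<noteq> {}" and S: "S \<subseteq> Pow X" "oddtown_mod4 S"
  shows "card S < card X + (if card X mod 4 = 3 then 1 else 0)"
proof (rule ccontr)
  assume neg: "\<not> ?thesis"
  have *: "k mod 4 = 3" if "card X \<le> k" "k \<le> card S" for k
  proof -
    obtain T where "T \<subseteq> S" "card T = k"
      using obtain_subset_with_card_n[OF \<open>k \<le> card S\<close>] by blast
    then show ?thesis
      using oddtown_card_mod4[OF X, of T] S that(1) oddtown_mod4_subset by blast
  qed
  have mod: "card X mod 4 = 3" using *[of "card X"] neg by (auto split: if_splits)
  then show False using *[of "card X + 1"] neg by (simp split: if_splits) presburger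
qed

lemma dist_2_mod4_card_bound:
  assumes X: "finite X" "X \<noteq> {}" and \<E>: "\<E> \<subseteq> Pow X"
    and dist: "\<And>A B. A \<in> \<E> \<Longrightarrow> B \<in> \<E> \<Longrightarrow> A \<noteq> B \<Longrightarrow> card (sym_diff A B) mod 4 = 2"
  shows "card \<E> \<le> card X + (if card X mod 4 = 3 then 1 else 0)"
proof (cases "\<E> = {}")
  case False
  then obtain C where C: "C \<in> \<E>" by blast
  \<comment> \<open>Translation by C preserves distances and turns distances from C into sizes. C
    itself would become the empty set and is left out, which turns the strict bound into a weak
    one.\<close>
  let ?S = "sym_diff C ` (\<E> - {C})"
  have fin: "finite \<E>" "\<And>A. A \<in> \<E> \<Longrightarrow> finite A"
    using X \<E> finite_subset by blast+
  have "oddtown_mod4 ?S"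
    unfolding oddtown_mod4_def
  proof (intro conjI ballI impI)
    fix V assume "V \<in> ?S"
    then show "card V mod 4 = 2" using dist C by auto
  next
    fix V W assume "V \<in> ?S" "W \<in> ?S" and ne: "V \<noteq> W"
    then obtain A B where AB: "A \<in> \<E> - {C}" "B \<in> \<E> - {C}" "V = sym_diff C A" "W = sym_diff C B"
      by blast
    then have "card (sym_diff V W) mod 4 = 2"
      using ne sym_diff_cancel[of C A B] dist[of A B] by auto
    moreover have "card V mod 4 = 2" "card W mod 4 = 2" "finite V" "finite W"
      using AB C dist[of C A] dist[of C B] fin by auto
    \<comment> \<open>Twice the intersection is 2 + 2 - 2 = 2 modulo 4.\<close>
    ultimately show "odd (card (V \<inter> W))"
      using card_sym_diff_add_Int[of V W] by presburger
  qed
  moreover have "?S \<subseteq> Pow X" using C \<E> by blast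
  ultimately have "card ?S < card X + (if card X mod 4 = 3 then 1 else 0)"
    using oddtown_card_bound[OF X] by blast
  moreover have "card ?S = card \<E> - 1"
    using card_image[OF inj_sym_diff] card_Diff_singleton[OF C] by metis
  ultimately show ?thesis by linarith
qed simp

section \<open>Upper bound through the two parity classes\<close>

lemma dist_avoids_card_bound:
  assumes "n \<ge> 1" "\<F> \<subseteq> Pow {1..n}" "dist_avoids_multiples_of_4 \<F>"
  shows "card \<F> \<le> size_bound n"
proof -
  have fin: "finite \<F>" using assms(2) finite_subset by blast
  have finA: "finite A" if "A \<in> \<F>" for A
    using that assms(2) finite_subset[of A "{1..n}"] by blast
  have bound: "card \<E> \<le> n + (if n mod 4 = 3 then 1 else 0)"
    if \<E>: "\<E> \<subseteq> \<F>" "\<And>A B. A \<in> \<E> \<Longrightarrow> B \<in> \<E> \<Longrightarrow> even (card A) \<longleftrightarrow> even (card B)" for \<E>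
  proof -
    have "card (sym_diff A B) mod 4 = 2" if "A \<in> \<E>" "B \<in> \<E>" "A \<noteq> B" for A B
    proof -
      have "\<not> 4 dvd card (sym_diff A B)"
        using assms(3) that \<E>(1) unfolding dist_avoids_multiples_of_4_def set_dist_def by blast
      moreover have "even (card (sym_diff A B))"
        using even_card_sym_diff[of A B] finA \<E> that by blast
      ultimately show ?thesis by presburger
    qed
    then show ?thesis
      using dist_2_mod4_card_bound[of "{1..n}" \<E>] assms(1,2) \<E>(1) by auto
  qed
  have "card \<F> = card {A\<in>\<F>. even (card A)} + card {A\<in>\<F>. odd (card A)}"
    using fin by (subst card_Un_disjoint[symmetric]) (auto intro: arg_cong[where f = card])
  also have "\<dots> \<le> size_bound n"
  proof -
    have "card {A\<in>\<F>. even (card A)} \<le> n + (if n mod 4 = 3 then 1 else 0)"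
      "card {A\<in>\<F>. odd (card A)} \<le> n + (if n mod 4 = 3 then 1 else 0)"
      by (rule bound; simp)+
    then show ?thesis unfolding size_bound_def by (simp split: if_splits)
  qed
  finally show ?thesis .
qed

section \<open>Sharpness: extremal families\<close>

lemma double_odd_family:
  assumes "n \<ge> 1" and \<G>: "\<G> \<subseteq> Pow {1..n}" "\<And>A. A \<in> \<G> \<Longrightarrow> odd (card A)"
    and dist: "dist_avoids_multiples_of_4 \<G>"
  obtains \<F> where "\<F> \<subseteq> Pow {1..n}" "dist_avoids_multiples_of_4 \<F>" "card \<F> = 2 * card \<G>"
proof -
  let ?H = "sym_diff {1} ` \<G>"
  have fin: "finite \<G>" using \<G>(1) finite_subset by blast
  have finG: "finite A" if "A \<in> \<G>" for A
    using that \<G>(1) finite_subset[of A "{1..n}"] by blast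
  have evenH: "even (card B)" "finite B" if B: "B \<in> ?H" for B
  proof -
    obtain A where A: "A \<in> \<G>" "B = sym_diff {1} A" using B by blast
    then show "even (card B)" "finite B"
      using even_card_sym_diff[of "{1}" A] finG \<G>(2) by simp_all
  qed
  \<comment> \<open>Translation by \<open>{1}\<close> flips the parity of sizes, so all distances
    between \<G> and its translate are odd. The two families are also disjoint for this reason,
    which doubles the size.\<close>
  have mixed: "\<not> 4 dvd set_dist A B" "\<not> 4 dvd set_dist B A" if "A \<in> \<G>" "B \<in> ?H" for A B
  proof -
    have "odd (set_dist A B)" "odd (set_dist B A)"
      using that even_card_sym_diff[of A B] even_card_sym_diff[of B A] finG evenH \<G>(2)
      unfolding set_dist_def by blast+
    then show "\<not> 4 dvd set_dist A B" "\<not> 4 dvd set_dist B A" by presburger+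
  qed
  have GG: "\<not> 4 dvd set_dist A B" if "A \<in> \<G>" "B \<in> \<G>" "A \<noteq> B" for A B
    using dist that unfolding dist_avoids_multiples_of_4_def by blast
  have HH: "\<not> 4 dvd set_dist A B" if AB: "A \<in> ?H" "B \<in> ?H" "A \<noteq> B" for A B
  proof -
    obtain A' B' where "A' \<in> \<G>" "B' \<in> \<G>" "A = sym_diff {1} A'" "B = sym_diff {1} B'"
      using AB by blast
    then show ?thesis
      using GG[of A' B'] AB(3) sym_diff_cancel[of "{1}" A' B'] unfolding set_dist_def by auto
  qed
  have "dist_avoids_multiples_of_4 (\<G> \<union> ?H)"
    unfolding dist_avoids_multiples_of_4_def
  proof (intro ballI impI)
    fix A B assume "A \<in> \<G> \<union> ?H" "B \<in> \<G> \<union> ?H" "A \<noteq> B"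
    then show "\<not> 4 dvd set_dist A B"
      using GG HH mixed by (elim UnE) simp_all
  qed
  moreover have "card (\<G> \<union> ?H) = 2 * card \<G>"
  proof -
    have "\<G> \<inter> ?H = {}" using evenH \<G>(2) by blast
    moreover have "card ?H = card \<G>" by (rule card_image[OF inj_sym_diff])
    ultimately show ?thesis using fin by (simp add: card_Un_disjoint)
  qed
  moreover have "\<G> \<union> ?H \<subseteq> Pow {1..n}" using \<G>(1) assms(1) by auto
  ultimately show ?thesis using that by blast
qed

lemma singletons_odd_family:
  fixes n :: nat
  assumes "n \<ge> 1"
  obtains \<G> where "\<G> \<subseteq> Pow {1..n}" "\<And>A. A \<in> \<G> \<Longrightarrow> odd (card A)"
    "dist_avoids_multiples_of_4 \<G>" "2 * card \<G> = size_bound n"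
proof -
  let ?S = "(\<lambda>i. {i}) ` {1..n}"
  have cS: "card ?S = n" by (subst card_image) auto
  have SS: "\<not> 4 dvd set_dist A B" if AB: "A \<in> ?S" "B \<in> ?S" "A \<noteq> B" for A B
  proof -
    obtain i j where "A = {i}" "B = {j}" "i \<noteq> j" using AB by blast
    then have "sym_diff A B = {i, j}" by blast
    then have "set_dist A B = 2" using \<open>i \<noteq> j\<close> by (simp add: set_dist_def)
    then show ?thesis by simp
  qed
  show ?thesis
  proof (cases "n mod 4 = 3")
    case False
    show ?thesis
    proof (rule that[of ?S])
      show "dist_avoids_multiples_of_4 ?S"
        unfolding dist_avoids_multiples_of_4_def using SS by blast
      show "2 * card ?S = size_bound n" using cS False by (simp add: size_bound_def)
    qed auto
  next
    case True
    \<comment> \<open>Here n is odd, so the whole set fits among the odd sets, and its distance n -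
      1 to each singleton is 2 modulo 4.\<close>
    let ?U = "{1..n}"
    have US: "\<not> 4 dvd set_dist A ?U" "\<not> 4 dvd set_dist ?U A" if "A \<in> ?S" for A
    proof -
      obtain i where i: "A = {i}" "i \<in> ?U" using \<open>A \<in> ?S\<close> by blast
      then have "sym_diff A ?U = ?U - {i}" "sym_diff ?U A = ?U - {i}" by auto
      then have "set_dist A ?U = n - 1" "set_dist ?U A = n - 1"
        using i by (simp_all add: set_dist_def)
      moreover have "\<not> 4 dvd n - 1" using True by presburger
      ultimately show "\<not> 4 dvd set_dist A ?U" "\<not> 4 dvd set_dist ?U A" by simp_all
    qed
    have oddn: "odd n" using True by presburger
    have "?U \<notin> ?S"
    proof
      assume "?U \<in> ?S"
      then obtain i where "?U = {i}" by blast
      then have "card ?U = 1" by simp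
      then show False using True by simp
    qed
    then have c: "card (insert ?U ?S) = n + 1" using cS by simp
    show ?thesis
    proof (rule that[of "insert ?U ?S"])
      show "dist_avoids_multiples_of_4 (insert ?U ?S)"
        unfolding dist_avoids_multiples_of_4_def using SS US by (metis insert_iff)
      show "2 * card (insert ?U ?S) = size_bound n"
        unfolding c using True by (simp add: size_bound_def)
    qed (use oddn in auto)
  qed
qed

theorem theorem1p1:
  fixes n :: nat
  assumes "n \<ge> 1"
  shows "(\<forall>\<F>. \<F> \<subseteq> Pow {1..n} \<and> dist_avoids_multiples_of_4 \<F> \<longrightarrow> card \<F> \<le> size_bound n)
    \<and> (\<exists>\<F>. \<F> \<subseteq> Pow {1..n} \<and> dist_avoids_multiples_of_4 \<F> \<and> card \<F> = size_bound n)"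
proof (intro conjI allI impI)
  fix \<F> assume "\<F> \<subseteq> Pow {1..n} \<and> dist_avoids_multiples_of_4 \<F>"
  then show "card \<F> \<le> size_bound n" using dist_avoids_card_bound[OF assms] by blast
next
  show "\<exists>\<F>. \<F> \<subseteq> Pow {1..n} \<and> dist_avoids_multiples_of_4 \<F> \<and> card \<F> = size_bound n"
    by (metis singletons_odd_family[OF assms] double_odd_family[OF assms])
qed

end
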